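(* Let $\mathrm{H}:\mathbf{Top}_0\to\mathbf{Set}$ be an R-subset system. If $X$ is a $T_0$ space and $Y$ is an $\mathrm{H}$-sober space, then the function space $\mathbf{Top}_0(X,Y)$ of all continuous functions $f:X\to Y$, equipped with the topology of pointwise convergence (i.e., the relative product topology as a subspace of $Y^X$), is $\mathrm{H}$-sober.
   Context: $\mathbf{Top}_0$ is the category of all $T_0$ spaces with continuous mappings. A subset $A$ of a space $X$ is irreducible if it is nonempty and whenever $A\subseteq F_1\cup F_2$ with $F_1,F_2$ closed in $X$, then $A\subseteq F_1$ or $A\subseteq F_2$. An R-subset system (irreducible subset system) is a covariant functor $\mathrm{H}:\mathbf{Top}_0\to\mathbf{Set}$ such that (i) for every $T_0$ space $X$, $\mathrm{H}(X)$ is a set of irreducible subsets of $X$ which contains all singletons $\{x\}$, $x\in X$; (ii) for every continuous mapping $f:X\to Y$ between $T_0$ spaces and every $A\in \mathrm{H}(X)$, $\mathrm{H}(f)(A)=f(A)\in \mathrm{H}(Y)$. A $T_0$ space $X$ is $\mathrm{H}$-sober if for every $A\in\mathrm{H}(X)$ there is a (necessarily unique) point $x\in X$ with $\overline{A}=\overline{\{x\}}$. *)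

theory Defs
  imports "HOL-Analysis.Analysis"
begin

text \<open>
  Since no type contains the carriers of all spaces, the category of all
  \<open>T\<^sub>0\<close> spaces is represented by the \<open>T\<^sub>0\<close> topologies on a type \<open>'u\<close>, which plays the
  role of a universe of points.  The type \<open>'u\<close> is arbitrary, so it can be taken as large as desired.
  A space over another type belongs to the category if it has a homeomorphic copy over \<open>'u\<close>.
\<close>

definition irreducible_in :: "'a topology \<Rightarrow> 'a set \<Rightarrow> bool" where
  "irreducible_in X A \<longleftrightarrow>
     A \<subseteq> topspace X \<and> A \<noteq> {} \<and>
     (\<forall>F1 F2. closedin X F1 \<and> closedin X F2 \<and> A \<subseteq> F1 \<union> F2 \<longrightarrow> A \<subseteq> F1 \<or> A \<subseteq> F2)"

text \<open>
  Only the object part \<open>H\<close> of the functor is a parameter.  The action on a continuous map \<open>f\<close> is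
  prescribed to be \<open>A \<mapsto> f ` A\<close>, which is well defined by the second conjunct and preserves
  identities and composition.
\<close>

definition R_subset_system :: "('u topology \<Rightarrow> 'u set set) \<Rightarrow> bool" where
  "R_subset_system H \<longleftrightarrow>
     (\<forall>X. t0_space X \<longrightarrow>
        (\<forall>A \<in> H X. irreducible_in X A) \<and> (\<forall>x \<in> topspace X. {x} \<in> H X)) \<and>
     (\<forall>X Y f. t0_space X \<and> t0_space Y \<and> continuous_map X Y f \<longrightarrow>
        (\<forall>A \<in> H X. f ` A \<in> H Y))"

definition in_Top0 :: "'u itself \<Rightarrow> 'a topology \<Rightarrow> bool" where
  "in_Top0 (_ :: 'u itself) X \<longleftrightarrow>
     t0_space X \<and> (\<exists>U :: 'u topology. U homeomorphic_space X)"

text \<open>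
  The value of \<open>H\<close> at a space over an arbitrary type, obtained by transport along
  homeomorphisms.  By the functor axioms the choice of the copy is irrelevant, and over \<open>'u\<close>
  itself nothing changes; see \<open>system_at_copy\<close> and \<open>system_at_same\<close> below.
\<close>

definition system_at :: "('u topology \<Rightarrow> 'u set set) \<Rightarrow> 'a topology \<Rightarrow> 'a set set" where
  "system_at H X = {h ` A | U h A. homeomorphic_map U X h \<and> A \<in> H U}"

definition H_sober :: "('u topology \<Rightarrow> 'u set set) \<Rightarrow> 'a topology \<Rightarrow> bool" where
  "H_sober H X \<longleftrightarrow>
     in_Top0 TYPE('u) X \<and>
     (\<forall>A \<in> system_at H X. \<exists>x \<in> topspace X. X closure_of A = X closure_of {x})"

text \<open>
  Functions are normalised to be \<open>undefined\<close> outside \<open>topspace X\<close>, because the product topology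
  has the extensional functions as its points.
\<close>

definition Top0_fun :: "'a topology \<Rightarrow> 'b topology \<Rightarrow> ('a \<Rightarrow> 'b) topology" where
  "Top0_fun X Y =
     subtopology (product_topology (\<lambda>_. Y) (topspace X)) {f. continuous_map X Y f}"

lemma system_at_copy:
  fixes H :: "'u topology \<Rightarrow> 'u set set" and X :: "'a topology"
  assumes H: "R_subset_system H" and X: "t0_space X" and h: "homeomorphic_map U X h"
  shows "system_at H X = (\<lambda>A. h ` A) ` H U"
proof
  show "(\<lambda>A. h ` A) ` H U \<subseteq> system_at H X"
    using h by (auto simp: system_at_def)
  show "system_at H X \<subseteq> (\<lambda>A. h ` A) ` H U"
  proof
    fix B assume "B \<in> system_at H X"
    then obtain V k A where k: "homeomorphic_map V X k" and A: "A \<in> H V" and B: "B = k ` A"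
      by (auto simp: system_at_def)
    obtain g where g: "homeomorphic_maps U X h g"
      using h homeomorphic_map_maps by blast
    have t0: "t0_space U" "t0_space V"
      using X h k homeomorphic_map_imp_homeomorphic_space homeomorphic_t0_space by blast+
    have cont: "continuous_map V U (g \<circ> k)"
      using g k by (meson continuous_map_compose homeomorphic_imp_continuous_map homeomorphic_maps_def)
    have "(g \<circ> k) ` A \<in> H U"
      using H t0 cont A unfolding R_subset_system_def by blast
    moreover have "A \<subseteq> topspace V"
      using H t0 A unfolding R_subset_system_def irreducible_in_def by blast
    then have "k ` A \<subseteq> topspace X"
      using k homeomorphic_imp_surjective_map by blast
    then have "h ` (g \<circ> k) ` A = B"
      using g unfolding B homeomorphic_maps_def by (force simp: image_iff)
    ultimately show "B \<in> (\<lambda>A. h ` A) ` H U"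
      by blast
  qed
qed

corollary system_at_same:
  fixes H :: "'u topology \<Rightarrow> 'u set set" and X :: "'u topology"
  assumes "R_subset_system H" and "t0_space X"
  shows "system_at H X = H X"
  using system_at_copy[OF assms, of X id] by (simp add: homeomorphic_map_id)

end

theory Submission
  imports Defs
begin

text \<open>
  Let \<open>A\<close> be a member of the system at the function space.  Evaluation at a point \<open>x\<close> is continuous,
  so functoriality puts the set \<open>A(x)\<close> of values at \<open>x\<close> into the system at \<open>Y\<close>, and soberness of
  \<open>Y\<close> yields \<open>g x\<close> with the same closure as \<open>A(x)\<close>.  Two sets have the same closure iff they
  meet the same open sets, so for \<open>V\<close> open in \<open>Y\<close>, the point \<open>g x\<close> lies in \<open>V\<close> iff
  \<open>f x\<close> lies in \<open>V\<close> for some \<open>f \<in> A\<close>.  Everything follows from this equivalence.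
  It exhibits the preimage of \<open>V\<close> under \<open>g\<close> as the union
  of the preimages under the members of \<open>A\<close>, whence \<open>g\<close> is continuous
  (\<open>continuous_map_if_vimage_eq_Union\<close>).  It shows that each member of \<open>A\<close> is a
  pointwise specialization of \<open>g\<close>, hence lies in the closure of \<open>{g}\<close>, since closures of boxes in a
  product are formed coordinatewise.  Finally it shows that \<open>A\<close> meets every subbasic neighbourhood
  of \<open>g\<close>; irreducibility of \<open>A\<close> passes from these to their finite intersections
  (\<open>irreducible_in_meets_finite_Inter\<close>), so \<open>g\<close> lies in the closure of \<open>A\<close>.
\<close>

section \<open>Irreducible sets\<close>

lemma irreducible_in_continuous_image:
  assumes A: "irreducible_in X A" and f: "continuous_map X Y f"
  shows "irreducible_in Y (f ` A)"
  unfolding irreducible_in_def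
proof (intro conjI allI impI)
  have AX: "A \<subseteq> topspace X" "A \<noteq> {}"
    using A by (auto simp: irreducible_in_def)
  show "f ` A \<subseteq> topspace Y"
    using AX f by (meson continuous_map_image_subset_topspace image_mono order_trans)
  show "f ` A \<noteq> {}"
    using AX by auto
  fix F1 F2
  assume F: "closedin Y F1 \<and> closedin Y F2 \<and> f ` A \<subseteq> F1 \<union> F2"
  let ?P = "\<lambda>F. {x \<in> topspace X. f x \<in> F}"
  have "closedin X (?P F1)" "closedin X (?P F2)"
    using F f closedin_continuous_map_preimage by blast+
  moreover have "A \<subseteq> ?P F1 \<union> ?P F2"
    using AX F by auto
  ultimately have "A \<subseteq> ?P F1 \<or> A \<subseteq> ?P F2"
    using A unfolding irreducible_in_def by blast
  then show "f ` A \<subseteq> F1 \<or> f ` A \<subseteq> F2"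
    by auto
qed

text \<open>
  The defining property in terms of complements: two open sets that meet an irreducible set
  meet it in a common point.
\<close>

lemma irreducible_in_meets_Int:
  assumes A: "irreducible_in X A" and "openin X U" "openin X V"
    and "A \<inter> U \<noteq> {}" "A \<inter> V \<noteq> {}"
  shows "A \<inter> (U \<inter> V) \<noteq> {}"
proof
  assume "A \<inter> (U \<inter> V) = {}"
  then have "A \<subseteq> (topspace X - U) \<union> (topspace X - V)"
    using A unfolding irreducible_in_def by blast
  moreover have "closedin X (topspace X - U)" "closedin X (topspace X - V)"
    using assms by auto
  ultimately have "A \<subseteq> topspace X - U \<or> A \<subseteq> topspace X - V"
    using A unfolding irreducible_in_def by blast
  then show False
    using assms by blast
qed

text \<open>
  Intersecting with \<open>topspace X\<close> makes the empty family contribute an open set of \<open>X\<close>.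
\<close>

lemma irreducible_in_meets_finite_Inter:
  assumes A: "irreducible_in X A" and "finite I"
    and "\<And>i. i \<in> I \<Longrightarrow> openin X (U i)" "\<And>i. i \<in> I \<Longrightarrow> A \<inter> U i \<noteq> {}"
  shows "A \<inter> (topspace X \<inter> (\<Inter>i\<in>I. U i)) \<noteq> {}"
proof -
  have "openin X (topspace X \<inter> (\<Inter>i\<in>I. U i)) \<and> A \<inter> (topspace X \<inter> (\<Inter>i\<in>I. U i)) \<noteq> {}"
    using assms(2-)
  proof (induction I)
    case empty
    then show ?case
      using A by (auto simp: irreducible_in_def)
  next
    case (insert i I)
    let ?W = "topspace X \<inter> (\<Inter>i\<in>I. U i)"
    have "openin X ?W \<and> A \<inter> ?W \<noteq> {}"
      by (rule insert.IH) (use insert.prems in blast)+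
    then have W: "openin X ?W" "A \<inter> ?W \<noteq> {}"
      by blast+
    have "topspace X \<inter> (\<Inter>i\<in>insert i I. U i) = U i \<inter> ?W"
      by auto
    moreover have "A \<inter> (U i \<inter> ?W) \<noteq> {}"
      by (rule irreducible_in_meets_Int[OF A _ W(1) _ W(2)]) (use insert.prems in blast)+
    moreover have "openin X (U i \<inter> ?W)"
      by (rule openin_Int[OF _ W(1)]) (use insert.prems in blast)
    ultimately show ?case
      by metis
  qed
  then show ?thesis ..
qed

section \<open>The transported subset system\<close>

text \<open>
  Irreducibility of the members and functoriality survive the transport: a continuous map between
  spaces that have copies over \<open>'u\<close> becomes, after composition with the homeomorphisms, a map
  between these copies, where the axioms for \<open>H\<close> apply.
\<close>

lemma system_at_irreducible:
  fixes H :: "'u topology \<Rightarrow> 'u set set"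
  assumes H: "R_subset_system H" and X: "t0_space X" and A: "A \<in> system_at H X"
  shows "irreducible_in X A"
proof -
  obtain U h B where h: "homeomorphic_map U X h" and B: "B \<in> H U" and "A = h ` B"
    using A by (auto simp: system_at_def)
  moreover have "t0_space U"
    using X h homeomorphic_map_imp_homeomorphic_space homeomorphic_t0_space by blast
  then have "irreducible_in U B"
    using H B unfolding R_subset_system_def by blast
  ultimately show ?thesis
    using irreducible_in_continuous_image homeomorphic_imp_continuous_map by blast
qed

lemma system_at_continuous_image:
  fixes H :: "'u topology \<Rightarrow> 'u set set"
  assumes H: "R_subset_system H" and X: "t0_space X" and Y: "in_Top0 TYPE('u) Y"
    and f: "continuous_map X Y f" and A: "A \<in> system_at H X"
  shows "f ` A \<in> system_at H Y"
proof -
  obtain U h B where h: "homeomorphic_map U X h" and B: "B \<in> H U" and AB: "A = h ` B"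
    using A by (auto simp: system_at_def)
  obtain V :: "'u topology" and k l where kl: "homeomorphic_maps V Y k l"
    using Y unfolding in_Top0_def homeomorphic_space_def by blast
  have k: "homeomorphic_map V Y k"
    using kl homeomorphic_map_maps by blast
  have t0: "t0_space U" "t0_space V"
    using X Y h k homeomorphic_map_imp_homeomorphic_space homeomorphic_t0_space
    unfolding in_Top0_def by blast+
  have "continuous_map U V (l \<circ> (f \<circ> h))"
    using h kl f
    by (meson continuous_map_compose homeomorphic_imp_continuous_map homeomorphic_maps_def)
  then have "(l \<circ> (f \<circ> h)) ` B \<in> H V"
    using H t0 B unfolding R_subset_system_def by blast
  then have "k ` ((l \<circ> (f \<circ> h)) ` B) \<in> system_at H Y"
    using k by (auto simp: system_at_def)
  moreover have "A \<subseteq> topspace X"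
    using system_at_irreducible[OF H X A] by (simp add: irreducible_in_def)
  then have "f ` A \<subseteq> topspace Y"
    using f by (meson continuous_map_image_subset_topspace image_mono order_trans)
  then have "k ` ((l \<circ> (f \<circ> h)) ` B) = f ` A"
    using kl unfolding AB homeomorphic_maps_def by (force simp: image_iff)
  ultimately show ?thesis
    by simp
qed

section \<open>Topology of pointwise convergence\<close>

lemma topspace_Top0_fun:
  "topspace (Top0_fun X Y) = {f \<in> extensional (topspace X). continuous_map X Y f}"
  by (auto simp: Top0_fun_def PiE_def continuous_map_def)

lemma t0_space_Top0_fun:
  assumes "t0_space Y"
  shows "t0_space (Top0_fun X Y)"
  using assms by (simp add: Top0_fun_def t0_space_subtopology t0_space_product_topology)

lemma continuous_map_Top0_fun_eval:
  assumes "x \<in> topspace X"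
  shows "continuous_map (Top0_fun X Y) Y (\<lambda>f. f x)"
  unfolding Top0_fun_def
  using assms by (intro continuous_map_from_subtopology continuous_map_product_projection)

lemma Top0_fun_closure_of_singleton:
  assumes "g \<in> topspace (Top0_fun X Y)" and "f \<in> topspace (Top0_fun X Y)"
    and "\<And>x. x \<in> topspace X \<Longrightarrow> f x \<in> Y closure_of {g x}"
  shows "f \<in> Top0_fun X Y closure_of {g}"
proof -
  have "PiE (topspace X) (\<lambda>x. {g x}) = {g}"
    using assms(1) by (auto simp: topspace_Top0_fun PiE_singleton)
  then have "product_topology (\<lambda>_. Y) (topspace X) closure_of {g}
      = PiE (topspace X) (\<lambda>x. Y closure_of {g x})"
    using closure_of_product_topology[of "\<lambda>_. Y" "topspace X" "\<lambda>x. {g x}"] by simp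
  moreover have "f \<in> PiE (topspace X) (\<lambda>x. Y closure_of {g x})"
    using assms(2,3) by (auto simp: topspace_Top0_fun PiE_def)
  moreover have "{f. continuous_map X Y f} \<inter> {g} = {g}" "continuous_map X Y f"
    using assms(1,2) by (auto simp: topspace_Top0_fun)
  ultimately show ?thesis
    unfolding Top0_fun_def closure_of_subtopology by simp
qed

text \<open>
  A neighbourhood of \<open>g\<close> contains a finite intersection of subbasic ones, and an irreducible set
  that meets the latter separately meets their intersection.
\<close>

lemma irreducible_in_Top0_fun_closure:
  assumes A: "irreducible_in (Top0_fun X Y) A" and g: "g \<in> topspace (Top0_fun X Y)"
    and meets: "\<And>x V. \<lbrakk>x \<in> topspace X; openin Y V; g x \<in> V\<rbrakk> \<Longrightarrow> \<exists>f\<in>A. f x \<in> V"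
  shows "g \<in> Top0_fun X Y closure_of A"
  unfolding in_closure_of
proof (intro conjI allI impI g)
  fix T assume T: "g \<in> T \<and> openin (Top0_fun X Y) T"
  let ?F = "Top0_fun X Y"
  obtain W where W: "openin (product_topology (\<lambda>_. Y) (topspace X)) W"
    and TW: "T = W \<inter> {f. continuous_map X Y f}"
    using T by (auto simp: Top0_fun_def openin_subtopology)
  have "g \<in> W"
    using T TW by blast
  obtain U where fin: "finite {x \<in> topspace X. U x \<noteq> topspace Y}"
    and U: "\<And>x. x \<in> topspace X \<Longrightarrow> openin Y (U x)"
    and gU: "g \<in> PiE (topspace X) U" and UW: "PiE (topspace X) U \<subseteq> W"
    using bspec[OF W[unfolded openin_product_topology_alt] \<open>g \<in> W\<close>]
    by (elim exE conjE) (rule that, assumption, blast, assumption+)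
  define I where "I = {x \<in> topspace X. U x \<noteq> topspace Y}"
  define S where "S x = {f \<in> topspace ?F. f x \<in> U x}" for x
  have "A \<inter> (topspace ?F \<inter> (\<Inter>x\<in>I. S x)) \<noteq> {}"
  proof (rule irreducible_in_meets_finite_Inter[OF A])
    show "finite I"
      using fin by (simp add: I_def)
    fix x assume "x \<in> I"
    then have x: "x \<in> topspace X"
      by (simp add: I_def)
    show "openin ?F (S x)"
      unfolding S_def
      using openin_continuous_map_preimage[OF continuous_map_Top0_fun_eval[OF x] U[OF x]] .
    have "g x \<in> U x"
      using gU x by auto
    then obtain f where "f \<in> A" "f x \<in> U x"
      using meets x U by blast
    then show "A \<inter> S x \<noteq> {}"
      using A by (auto simp: S_def irreducible_in_def)
  qed
  then obtain f where f: "f \<in> A" "f \<in> topspace ?F" "\<And>x. x \<in> I \<Longrightarrow> f x \<in> U x"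
    by (auto simp: S_def)
  have "f x \<in> U x" if "x \<in> topspace X" for x
    using f that by (cases "x \<in> I") (auto simp: I_def topspace_Top0_fun continuous_map_def)
  then have "f \<in> PiE (topspace X) U"
    using f by (auto simp: topspace_Top0_fun PiE_def)
  then have "f \<in> T"
    using f UW TW by (auto simp: topspace_Top0_fun)
  then show "\<exists>f. f \<in> A \<and> f \<in> T"
    using f by blast
qed

section \<open>Soberness of the function space\<close>

lemma continuous_map_if_vimage_eq_Union:
  assumes A: "\<And>f. f \<in> A \<Longrightarrow> continuous_map X Y f"
    and g: "\<And>x. x \<in> topspace X \<Longrightarrow> g x \<in> topspace Y"
    and iff: "\<And>x V. \<lbrakk>x \<in> topspace X; openin Y V\<rbrakk> \<Longrightarrow> g x \<in> V \<longleftrightarrow> (\<exists>f\<in>A. f x \<in> V)"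
  shows "continuous_map X Y g"
  unfolding continuous_map_def
proof (intro conjI allI impI)
  show "g \<in> topspace X \<rightarrow> topspace Y"
    using g by blast
  fix V assume V: "openin Y V"
  have "{x \<in> topspace X. g x \<in> V} = (\<Union>f\<in>A. {x \<in> topspace X. f x \<in> V})"
    using iff V by blast
  then show "openin X {x \<in> topspace X. g x \<in> V}"
    using A V openin_continuous_map_preimage by fastforce
qed

lemma closure_of_eq_singleton_imp_mem_iff:
  assumes "Y closure_of B = Y closure_of {y}" and "openin Y V"
  shows "y \<in> V \<longleftrightarrow> (\<exists>b\<in>B. b \<in> V)"
proof -
  have "V \<inter> B = {} \<longleftrightarrow> V \<inter> {y} = {}"
    using assms by (metis openin_Int_closure_of_eq_empty)
  then show ?thesis
    by blast
qed

theorem theorem4p30: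
  fixes H :: "'u topology \<Rightarrow> 'u set set"
    and X :: "'a topology" and Y :: "'b topology"
  assumes "R_subset_system H"
    and "t0_space X"
    and "H_sober H Y"
    and "\<exists>U :: 'u topology. U homeomorphic_space (Top0_fun X Y)"
  shows "H_sober H (Top0_fun X Y)"
proof -
  let ?F = "Top0_fun X Y"
  have Y: "in_Top0 TYPE('u) Y"
    and sober: "\<And>B. B \<in> system_at H Y \<Longrightarrow> \<exists>y \<in> topspace Y. Y closure_of B = Y closure_of {y}"
    using assms(3) by (auto simp: H_sober_def)
  have t0: "t0_space ?F"
    using Y by (simp add: in_Top0_def t0_space_Top0_fun)
  have "\<exists>g \<in> topspace ?F. ?F closure_of A = ?F closure_of {g}" if A: "A \<in> system_at H ?F" for A
  proof -
    have irr: "irreducible_in ?F A"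
      using system_at_irreducible[OF assms(1) t0 A] .
    have AF: "A \<subseteq> topspace ?F"
      using irr by (simp add: irreducible_in_def)
    have "\<exists>y \<in> topspace Y. Y closure_of ((\<lambda>f. f x) ` A) = Y closure_of {y}"
      if "x \<in> topspace X" for x
      using system_at_continuous_image[OF assms(1) t0 Y continuous_map_Top0_fun_eval A] that sober
      by blast
    then obtain g' where g': "\<And>x. x \<in> topspace X \<Longrightarrow>
        g' x \<in> topspace Y \<and> Y closure_of ((\<lambda>f. f x) ` A) = Y closure_of {g' x}"
      by metis
    define g where "g = restrict g' (topspace X)"
    have gY: "g x \<in> topspace Y"
      and cl: "Y closure_of ((\<lambda>f. f x) ` A) = Y closure_of {g x}" if "x \<in> topspace X" for x
      using g' that by (auto simp: g_def)
    have iff: "g x \<in> V \<longleftrightarrow> (\<exists>f\<in>A. f x \<in> V)" if "x \<in> topspace X" "openin Y V" for x V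
      using closure_of_eq_singleton_imp_mem_iff[OF cl[OF that(1)] that(2)] by simp
    have "continuous_map X Y g"
    proof (rule continuous_map_if_vimage_eq_Union)
      show "continuous_map X Y f" if "f \<in> A" for f
        using AF that by (auto simp: topspace_Top0_fun)
    qed (fact gY iff)+
    then have gF: "g \<in> topspace ?F"
      by (simp add: topspace_Top0_fun g_def)
    have "f \<in> ?F closure_of {g}" if f: "f \<in> A" for f
    proof (rule Top0_fun_closure_of_singleton[OF gF])
      show fF: "f \<in> topspace ?F"
        using AF f by blast
      fix x assume x: "x \<in> topspace X"
      have "f x \<in> topspace Y"
        using fF x by (auto simp: topspace_Top0_fun continuous_map_def)
      then show "f x \<in> Y closure_of {g x}"
        using iff[OF x] f by (auto simp: in_closure_of)
    qed
    then have "?F closure_of A \<subseteq> ?F closure_of {g}"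
      by (intro closure_of_minimal) auto
    moreover have "g \<in> ?F closure_of A"
      using irreducible_in_Top0_fun_closure[OF irr gF] iff by blast
    then have "?F closure_of {g} \<subseteq> ?F closure_of A"
      by (intro closure_of_minimal) auto
    ultimately show ?thesis
      using gF by blast
  qed
  then show ?thesis
    using assms(4) t0 by (auto simp: H_sober_def in_Top0_def)
qed

end
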